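(* Let $$\hat P=\Phi_2(x)\hat D_x^2+\Phi_1(x)\hat D_x+\Phi_0(x),\qquad \hat M=g(x)\hat D_x^{-1}+k(x),$$ be a second order linear differential operator and a first order linear integral operator, where $\Phi_0,\Phi_1,\Phi_2,g,k$ are sufficiently smooth functions. Suppose that, on functions $u(x)$ satisfying the boundary condition $$\big[\Phi_2(x)u'(x)-\Phi_2'(x)u(x)+\Phi_1(x)u(x)\big]_{x=x_0}=0,$$ the products $\hat P\hat M$ and $\hat M\hat P$ are differential operators and the Heisenberg relation $[\hat P,\hat M]=\hat 1$ holds. Then $\hat P$ and $\hat M$ are of the form $$\hat P=\frac{1}{Y'(x)^2}\big[Y(x)+c_0\big]\hat D_x^2+\frac{1}{Y'(x)^3}\Big[(c_1+3)Y'(x)^2-3(Y(x)+c_0)Y''(x)\Big]\hat D_x$$ $$\qquad-\frac{1}{Y'(x)^4}\Big[(Y(x)+c_0)\big(Y'''(x)Y'(x)-3Y''(x)^2\big)+(c_1+3)Y'(x)^2Y''(x)\Big],$$ $$\hat M=Y'(x)\,\hat D_x^{-1}+k_0,$$ for some constants $c_0,c_1,k_0$ and some function $Y(x)$ with $Y(x_0)=0$ (namely $Y(x)=\int_{x_0}^x g(\xi)\,d\xi$).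
   Context: $x$ is a real variable, $x_0$ is a constant, $\hat D_x=\frac{d}{dx}$, $\hat D_x^{-1}u(x)=\int_{x_0}^x u(\xi)\,d\xi$, primes denote derivatives with respect to $x$, and $[\hat P,\hat M]=\hat P\hat M-\hat M\hat P$. A product of operators is a differential operator if it contains no terms with $\hat D_x^{-k}$, $k\ge1$. *)

theory Defs
  imports "HOL-Analysis.Analysis"
begin

text \<open>
  The domain of the variable \<open>x\<close> is an arbitrary nondegenerate interval \<open>I\<close> (open, closed, half-open,
  unbounded).  Derivatives are taken within \<open>I\<close>, so they are one-sided at an endpoint
  belonging to \<open>I\<close> (the base point \<open>x0\<close> may be such an endpoint) and the usual ones elsewhere.
\<close>

definition Dx :: "real set \<Rightarrow> (real \<Rightarrow> real) \<Rightarrow> real \<Rightarrow> real" where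
  "Dx I f = (\<lambda>x. vector_derivative f (at x within I))"

definition Ck_on :: "nat \<Rightarrow> real set \<Rightarrow> (real \<Rightarrow> real) \<Rightarrow> bool" where
  "Ck_on n I f \<longleftrightarrow>
     (\<forall>m<n. \<forall>x\<in>I. (Dx I ^^ m) f differentiable (at x within I)) \<and>
     continuous_on I ((Dx I ^^ n) f)"

definition smooth_on :: "real set \<Rightarrow> (real \<Rightarrow> real) \<Rightarrow> bool" where
  "smooth_on I f \<longleftrightarrow> (\<forall>n. Ck_on n I f)"

text \<open>The interval integral is oriented, so \<open>x < x0\<close> is covered.\<close>

definition Dx_inv :: "real \<Rightarrow> (real \<Rightarrow> real) \<Rightarrow> real \<Rightarrow> real" where
  "Dx_inv x0 u = (\<lambda>x. LBINT \<xi>=ereal x0..ereal x. u \<xi>)"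

definition diff_op2 ::
  "real set \<Rightarrow> (real \<Rightarrow> real) \<Rightarrow> (real \<Rightarrow> real) \<Rightarrow> (real \<Rightarrow> real) \<Rightarrow> (real \<Rightarrow> real) \<Rightarrow> real \<Rightarrow> real" where
  "diff_op2 I \<Phi>2 \<Phi>1 \<Phi>0 u =
     (\<lambda>x. \<Phi>2 x * Dx I (Dx I u) x + \<Phi>1 x * Dx I u x + \<Phi>0 x * u x)"

definition int_op1 ::
  "real \<Rightarrow> (real \<Rightarrow> real) \<Rightarrow> (real \<Rightarrow> real) \<Rightarrow> (real \<Rightarrow> real) \<Rightarrow> real \<Rightarrow> real" where
  "int_op1 x0 g k u = (\<lambda>x. g x * Dx_inv x0 u x + k x * u x)"

text \<open>
  An operator is a differential operator on a class \<open>S\<close> of functions if its action on \<open>S\<close> is given by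
  a finite combination of the nonnegative powers of \<open>d/dx\<close>, i.e. no negative powers occur.
  The coefficients \<open>a i\<close> need not be regular.
\<close>

definition differential_operator_on ::
  "real set \<Rightarrow> (real \<Rightarrow> real) set \<Rightarrow> ((real \<Rightarrow> real) \<Rightarrow> real \<Rightarrow> real) \<Rightarrow> bool" where
  "differential_operator_on I S A \<longleftrightarrow>
     (\<exists>(n::nat) (a :: nat \<Rightarrow> real \<Rightarrow> real). \<forall>u\<in>S. \<forall>x\<in>I. A u x = (\<Sum>i\<le>n. a i x * (Dx I ^^ i) u x))"

definition commutator ::
  "((real \<Rightarrow> real) \<Rightarrow> real \<Rightarrow> real) \<Rightarrow> ((real \<Rightarrow> real) \<Rightarrow> real \<Rightarrow> real) \<Rightarrow> (real \<Rightarrow> real) \<Rightarrow> real \<Rightarrow> real" where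
  "commutator A B u = (\<lambda>x. (A \<circ> B) u x - (B \<circ> A) u x)"

definition bc_functions :: "real set \<Rightarrow> real \<Rightarrow> (real \<Rightarrow> real) \<Rightarrow> (real \<Rightarrow> real) \<Rightarrow> (real \<Rightarrow> real) set" where
  "bc_functions I x0 \<Phi>2 \<Phi>1 =
     {u. smooth_on I u \<and> \<Phi>2 x0 * Dx I u x0 - Dx I \<Phi>2 x0 * u x0 + \<Phi>1 x0 * u x0 = 0}"

end

theory Submission
  imports Defs
begin

text \<open>
  Up to differential operators, \<open>P M\<close> acts as \<open>A D\<^sup>-\<^sup>1\<close> with \<open>A = \<Phi>2 g'' + \<Phi>1 g' + \<Phi>0 g\<close>, and, after
  integration by parts using the boundary condition, \<open>M P\<close> acts as \<open>g D\<^sup>-\<^sup>1 h\<close> with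
  \<open>h = \<Phi>2'' - \<Phi>1' + \<Phi>0\<close>. Testing with polynomials that vanish to high order at the point of evaluation
  gives \<open>A = 0\<close> and \<open>g h = 0\<close>. Comparing the local terms of \<open>[P, M] = 1\<close> gives \<open>\<Phi>2 k' = 0\<close> and
  \<open>\<Phi>2 (2 g' + k'') + \<Phi>1 k' + g \<Phi>2' = 1\<close>. Connectedness of the interval forces \<open>k' = 0\<close>; then
  \<open>2 g' \<Phi>2 + g \<Phi>2' = 1\<close> shows that \<open>g\<close> vanishes on no subinterval, so \<open>h = 0\<close>, and
  it integrates to \<open>g\<^sup>2 \<Phi>2 = Y + c0\<close>. Finally \<open>g \<Phi>1 + 3 \<Phi>2 g'\<close> is constant and \<open>\<Phi>0\<close> follows from \<open>A = 0\<close>.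
\<close>

section \<open>Density and polynomial approximation\<close>

lemma continuous_const_on_dense:
  fixes f :: "real \<Rightarrow> real"
  assumes "continuous_on I f" and "D \<subseteq> I" and "I \<subseteq> closure D" and "\<And>t. t \<in> D \<Longrightarrow> f t = c" and "x \<in> I"
  shows "f x = c"
proof -
  have "closedin (top_of_set I) {t\<in>I. f t = c}"
    using assms(1) by (rule continuous_closedin_preimage_constant)
  then obtain T where T: "closed T" "{t\<in>I. f t = c} = I \<inter> T"
    by (auto simp: closedin_closed)
  have "D \<subseteq> T" using assms(2,4) T(2) by blast
  then have "closure D \<subseteq> T" using T(1) by (rule closure_minimal)
  then show ?thesis using assms(3,5) T(2) by blast
qed

lemma real_polynomial_function_shift: "real_polynomial_function (\<lambda>t. t - c)"
  using real_polynomial_function_diff[OF real_polynomial_function.intros(1)[OF bounded_linear_ident]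
      real_polynomial_function.intros(2)] .

lemma real_polynomial_function_shift_power_mult:
  "real_polynomial_function q \<Longrightarrow> real_polynomial_function (\<lambda>t. (t - c) ^ n * q t)"
  by (rule real_polynomial_function.intros(4)[OF
        real_polynomial_function_power[OF real_polynomial_function_shift]])

lemma continuous_on_real_polynomial_function:
  "real_polynomial_function p \<Longrightarrow> continuous_on S p"
  using continuous_on_polymonial_function[of p S] by (simp add: real_polynomial_function_eq)

text \<open>By Weierstrass, the integral of \<open>f * f\<close> equals that of
  \<open>f * (f - p)\<close> for every polynomial \<open>p\<close>, hence is arbitrarily small; a
  continuous nonnegative function with integral zero vanishes.\<close>

lemma zero_if_orthogonal_to_polynomials:
  fixes f :: "real \<Rightarrow> real"
  assumes f: "continuous_on {a..b} f" and "a < b"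
    and orth: "\<And>p. real_polynomial_function p \<Longrightarrow> integral {a..b} (\<lambda>t. f t * p t) = 0"
    and "t \<in> {a..b}"
  shows "f t = 0"
proof -
  have "\<exists>B. \<forall>t\<in>{a..b}. \<bar>f t\<bar> \<le> B"
    using compact_imp_bounded[OF compact_continuous_image[OF f compact_Icc]]
    by (auto simp: bounded_iff)
  then obtain B where B: "\<And>t. t \<in> {a..b} \<Longrightarrow> \<bar>f t\<bar> \<le> B" by blast
  have B0: "0 \<le> B" using B[of a] \<open>a < b\<close> by auto
  have small: "\<bar>integral {a..b} (\<lambda>t. f t * f t)\<bar> \<le> B * (b - a) * e" if "e > 0" for e
  proof -
    obtain p where p: "real_polynomial_function p" "\<And>t. t \<in> {a..b} \<Longrightarrow> \<bar>f t - p t\<bar> < e"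
      using Stone_Weierstrass_real_polynomial_function[OF compact_Icc f \<open>e > 0\<close>] by blast
    have pc: "continuous_on {a..b} p" by (rule continuous_on_real_polynomial_function[OF p(1)])
    have "integral {a..b} (\<lambda>t. f t * f t) = integral {a..b} (\<lambda>t. f t * f t) - integral {a..b} (\<lambda>t. f t * p t)"
      using orth[OF p(1)] by simp
    also have "\<dots> = integral {a..b} (\<lambda>t. f t * f t - f t * p t)"
      by (rule integral_diff[symmetric]; intro integrable_continuous_real continuous_intros f pc)
    also have "norm \<dots> \<le> (B * e) * (b - a)"
    proof (rule integral_bound)
      show "continuous_on {a..b} (\<lambda>t. f t * f t - f t * p t)" by (intro continuous_intros f pc)
      fix t assume t: "t \<in> {a..b}"
      have "norm (f t * f t - f t * p t) = \<bar>f t\<bar> * \<bar>f t - p t\<bar>"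
        by (simp add: abs_mult[symmetric] algebra_simps)
      also have "\<dots> \<le> B * e" using B[OF t] p(2)[OF t] B0 by (intro mult_mono) auto
      finally show "norm (f t * f t - f t * p t) \<le> B * e" .
    qed (use \<open>a < b\<close> in auto)
    finally show ?thesis by (simp add: algebra_simps)
  qed
  have "\<bar>integral {a..b} (\<lambda>t. f t * f t)\<bar> \<le> 0"
  proof (rule field_le_epsilon)
    fix e :: real assume "e > 0"
    let ?C = "B * (b - a)"
    have C: "0 \<le> ?C" using B0 \<open>a < b\<close> by simp
    \<comment> \<open>The \<open>+ 1\<close> keeps the denominator positive when the bound
      \<open>B\<close>, and with it \<open>?C\<close>, is zero.\<close>
    have "\<bar>integral {a..b} (\<lambda>t. f t * f t)\<bar> \<le> ?C * (e / (?C + 1))"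
      using small[of "e / (?C + 1)"] \<open>e > 0\<close> C by simp
    also have "\<dots> \<le> e"
      using C \<open>e > 0\<close> by (simp only: times_divide_eq_right) (simp add: divide_le_eq algebra_simps)
    finally show "\<bar>integral {a..b} (\<lambda>t. f t * f t)\<bar> \<le> 0 + e" by simp
  qed
  then have "integral {a..b} (\<lambda>t. f t * f t) = 0" by simp
  moreover have "continuous_on {a..b} (\<lambda>t. f t * f t)" by (intro continuous_intros f)
  ultimately have "f t * f t = 0"
    using integral_eq_0_iff[of a b "\<lambda>t. f t * f t"] \<open>a < b\<close> \<open>t \<in> {a..b}\<close> by simp
  then show ?thesis by simp
qed

section \<open>Derivatives and regularity within an interval\<close>

locale real_interval =
  fixes I :: "real set"
  assumes interval: "is_interval I" and interior_nonempty: "interior I \<noteq> {}"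
begin

text \<open>A nondegenerate interval is perfect, so derivatives within it are unique, also at its
  endpoints; this lets \<open>Dx\<close> be read off from any \<open>has_real_derivative\<close>
  fact.\<close>

lemma islimpt_interval: "x \<in> I \<Longrightarrow> x islimpt I"
proof (rule connected_imp_perfect)
  show "connected I" using interval by (simp add: is_interval_connected_1)
  show "I \<noteq> {y}" for y using interior_nonempty by auto
qed

lemma at_within_interval_nontrivial: "x \<in> I \<Longrightarrow> at x within I \<noteq> bot"
  using islimpt_interval trivial_limit_within[of x I] by simp

lemma interval_subset_closure_minus: "I \<subseteq> closure (I - {y})"
proof
  fix x assume "x \<in> I"
  show "x \<in> closure (I - {y})"
  proof (cases "x = y")
    case True
    then show ?thesis
      using islimpt_interval[OF \<open>x \<in> I\<close>] by (simp add: islimpt_in_closure)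
  next
    case False
    then show ?thesis using \<open>x \<in> I\<close> by (intro subsetD[OF closure_subset]) simp
  qed
qed

lemma Dx_eqI:
  "x \<in> I \<Longrightarrow> (f has_real_derivative y) (at x within I) \<Longrightarrow> Dx I f x = y"
  unfolding Dx_def
  by (intro vector_derivative_within at_within_interval_nontrivial)
     (simp_all add: has_real_derivative_iff_has_vector_derivative)

lemma has_Dx:
  "f differentiable (at x within I) \<Longrightarrow> (f has_real_derivative Dx I f x) (at x within I)"
  unfolding Dx_def has_real_derivative_iff_has_vector_derivative
  by (simp add: vector_derivative_works)

lemma has_derivative_cong_interval:
  assumes "\<And>t. t \<in> I \<Longrightarrow> f t = h t" and "x \<in> I"
  shows "(f has_real_derivative y) (at x within I) \<longleftrightarrow> (h has_real_derivative y) (at x within I)"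
  by (rule has_field_derivative_cong_eventually)
     (use assms in \<open>auto simp: eventually_at_filter\<close>)

text \<open>\<open>vector_derivative\<close> is a choice among all derivatives at the point, and
  functions agreeing on \<open>I\<close> have the same ones; the equality thus also covers points
  where no derivative exists.\<close>

lemma Dx_cong:
  assumes "\<And>t. t \<in> I \<Longrightarrow> f t = h t" and "x \<in> I"
  shows "Dx I f x = Dx I h x"
  using has_derivative_cong_interval[OF assms]
  by (simp add: Dx_def vector_derivative_def has_real_derivative_iff_has_vector_derivative)

lemma Dx_funpow_cong:
  assumes "\<And>t. t \<in> I \<Longrightarrow> f t = h t" and "x \<in> I"
  shows "(Dx I ^^ n) f x = (Dx I ^^ n) h x"
  using assms(2)
proof (induction n arbitrary: x)
  case (Suc n)
  then show ?case using Dx_cong[of "(Dx I ^^ n) f" "(Dx I ^^ n) h" x] by simp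
qed (use assms in auto)

lemma Ck_on_0: "Ck_on 0 I f \<longleftrightarrow> continuous_on I f"
  by (simp add: Ck_on_def)

text \<open>The innermost \<open>Dx I\<close> is peeled off, via \<open>funpow_swap1\<close>;
  inductions on the order and the extraction of single derivatives rest on this form.\<close>

lemma Ck_on_Suc:
  "Ck_on (Suc n) I f \<longleftrightarrow>
    (\<forall>x\<in>I. (f has_real_derivative Dx I f x) (at x within I)) \<and> Ck_on n I (Dx I f)"
proof -
  have "f differentiable at x within I \<longleftrightarrow> (f has_real_derivative Dx I f x) (at x within I)" for x
    using has_Dx real_differentiable_def by blast
  then show ?thesis
    by (auto simp: Ck_on_def All_less_Suc2 funpow_swap1)
qed

lemma Ck_on_imp_continuous: "Ck_on n I f \<Longrightarrow> continuous_on I f"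
  by (cases n) (auto simp: Ck_on_0 Ck_on_Suc intro!: DERIV_continuous_on)

lemma Ck_on_cong:
  assumes "\<And>t. t \<in> I \<Longrightarrow> f t = h t" and "Ck_on n I f"
  shows "Ck_on n I h"
  using assms
proof (induction n arbitrary: f h)
  case 0
  then show ?case using continuous_on_cong[of I I f h] by (simp add: Ck_on_0)
next
  case (Suc n)
  have eq: "Dx I f x = Dx I h x" if "x \<in> I" for x using Dx_cong[OF Suc.prems(1) that] .
  then have "Ck_on n I (Dx I h)" using Suc.IH[of "Dx I f" "Dx I h"] Suc.prems by (simp add: Ck_on_Suc)
  then show ?case
    using Suc.prems eq has_derivative_cong_interval[OF Suc.prems(1)] by (simp add: Ck_on_Suc)
qed

lemma smooth_on_Dx:
  assumes "smooth_on I f"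
  shows "smooth_on I (Dx I f)" and "continuous_on I f"
    and "x \<in> I \<Longrightarrow> (f has_real_derivative Dx I f x) (at x within I)"
proof -
  have *: "Ck_on (Suc n) I f" for n using assms by (simp add: smooth_on_def)
  then show "smooth_on I (Dx I f)" unfolding smooth_on_def by (simp add: Ck_on_Suc)
  show "continuous_on I f" using * Ck_on_imp_continuous by blast
  show "x \<in> I \<Longrightarrow> (f has_real_derivative Dx I f x) (at x within I)"
    using *[of 0] by (simp add: Ck_on_Suc)
qed

lemma Dx_polynomial:
  assumes "real_polynomial_function p"
  obtains q where "real_polynomial_function q" "\<And>t. (p has_real_derivative q t) (at t)"
    "\<And>t. t \<in> I \<Longrightarrow> Dx I p t = q t"
proof -
  obtain q where q: "real_polynomial_function q" "\<And>t. (p has_real_derivative q t) (at t)"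
    using has_real_derivative_polynomial_function[OF assms] by blast
  then show ?thesis
    by (intro that[of q] Dx_eqI) (auto intro: has_field_derivative_at_within)
qed

lemma smooth_on_polynomial:
  assumes "real_polynomial_function p"
  shows "smooth_on I p"
proof -
  have "Ck_on n I p" for n
    using assms
  proof (induction n arbitrary: p)
    case 0
    then show ?case
      by (simp add: Ck_on_0 continuous_on_real_polynomial_function)
  next
    case (Suc n)
    obtain q where q: "real_polynomial_function q" "\<And>t. (p has_real_derivative q t) (at t)"
      "\<And>t. t \<in> I \<Longrightarrow> Dx I p t = q t"
      using Dx_polynomial[OF Suc.prems] by blast
    have "Ck_on n I (Dx I p)"
      by (rule Ck_on_cong[of q]) (use q Suc.IH in auto)
    then show ?case
      using q by (auto simp: Ck_on_Suc has_field_derivative_at_within)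
  qed
  then show ?thesis by (simp add: smooth_on_def)
qed

text \<open>Each differentiation lowers the exponent of \<open>t - x\<close> by one and leaves a
  polynomial cofactor, namely \<open>?s\<close>; hence the induction over all \<open>q\<close> and
  \<open>N\<close>.\<close>

lemma Dx_funpow_vanish:
  assumes "real_polynomial_function q" and "x \<in> I" and "i < N"
  shows "(Dx I ^^ i) (\<lambda>t. (t - x) ^ N * q t) x = 0"
  using assms(1,3)
proof (induction i arbitrary: q N)
  case (Suc i)
  obtain M where N: "N = Suc M" using Suc.prems(2) by (cases N) simp_all
  obtain r where r: "real_polynomial_function r" "\<And>t. (q has_real_derivative r t) (at t)"
    using has_real_derivative_polynomial_function[OF Suc.prems(1)] by blast
  let ?s = "\<lambda>t. real N * q t + (t - x) * r t"
  have "real_polynomial_function (\<lambda>t. t - x)" by (rule real_polynomial_function_shift)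
  then have s: "real_polynomial_function ?s"
    by (rule real_polynomial_function.intros(3)[OF real_polynomial_function.intros(4)[OF
          real_polynomial_function.intros(2) Suc.prems(1)] real_polynomial_function.intros(4)[OF _ r(1)]])
  have "Dx I (\<lambda>t. (t - x) ^ N * q t) t = (t - x) ^ M * ?s t" if "t \<in> I" for t
  proof (rule Dx_eqI[OF that])
    show "((\<lambda>t. (t - x) ^ N * q t) has_real_derivative (t - x) ^ M * ?s t) (at t within I)"
      unfolding N
      by (rule DERIV_cong[OF DERIV_mult[OF DERIV_power_Suc[OF DERIV_diff[OF DERIV_ident DERIV_const]]
              has_field_derivative_at_within[OF r(2)]]])
         (simp add: algebra_simps)
  qed
  from Dx_funpow_cong[OF this \<open>x \<in> I\<close>, where n = i] show ?case
    using Suc.IH[OF s, of M] Suc.prems(2) unfolding N funpow_Suc_right comp_def by simp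
qed simp

section \<open>The integral operator based at \<open>x0\<close>\<close>

lemma closed_segment_subset_interval:
  "x \<in> I \<Longrightarrow> y \<in> I \<Longrightarrow> closed_segment x y \<subseteq> I"
  using interval is_interval_convex_1 closed_segment_subset by blast

lemma Dx_inv_base: "Dx_inv x0 u x0 = 0"
  by (simp add: Dx_inv_def)

lemma Dx_inv_eq_diff:
  assumes "x0 \<in> I" and "x \<in> I" and "continuous_on I u"
    and "\<And>t. t \<in> I \<Longrightarrow> (F has_real_derivative u t) (at t within I)"
  shows "Dx_inv x0 u x = F x - F x0"
proof -
  have sub: "{min x0 x..max x0 x} \<subseteq> I"
    using closed_segment_subset_interval[OF assms(1,2)]
    by (auto simp: closed_segment_eq_real_ivl min_def max_def split: if_splits)
  show ?thesis unfolding Dx_inv_def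
  proof (rule interval_integral_FTC_finite)
    show "continuous_on {min x0 x..max x0 x} u" using assms(3) sub continuous_on_subset by blast
    show "(F has_vector_derivative u t) (at t within {min x0 x..max x0 x})"
      if "min x0 x \<le> t" "t \<le> max x0 x" for t
    proof (rule has_vector_derivative_within_subset[OF _ sub])
      have "t \<in> I" using sub that by auto
      then show "(F has_vector_derivative u t) (at t within I)"
        using assms(4) by (simp add: has_real_derivative_iff_has_vector_derivative)
    qed
  qed
qed

text \<open>The fundamental theorem is applied on a compact \<open>{a..b}\<close> inside
  \<open>I\<close> that contains \<open>x0\<close> and coincides with \<open>I\<close> near
  \<open>x\<close>, so one-sided and two-sided derivatives are treated alike.\<close>

lemma has_derivative_Dx_inv:
  assumes "x0 \<in> I" and "x \<in> I" and u: "continuous_on I u"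
  shows "(Dx_inv x0 u has_real_derivative u x) (at x within I)"
proof -
  \<comment> \<open>Either there is room in \<open>I\<close> to the right of \<open>x\<close>, or
    \<open>b\<close> is the maximum of \<open>I\<close>; \<open>a\<close> is chosen
    symmetrically.\<close>
  obtain b where b: "b \<in> I" "b \<ge> x0" "b \<ge> x" "b > x \<or> (\<forall>y\<in>I. y \<le> b)"
  proof (cases "\<exists>y\<in>I. y > max x0 x")
    case False
    then show ?thesis using that[of "max x0 x"] assms(1,2) by (fastforce simp: max_def not_less)
  qed (use that in fastforce)
  obtain a where a: "a \<in> I" "a \<le> x0" "a \<le> x" "a < x \<or> (\<forall>y\<in>I. y \<ge> a)"
  proof (cases "\<exists>y\<in>I. y < min x0 x")
    case False
    then show ?thesis using that[of "min x0 x"] assms(1,2) by (fastforce simp: min_def not_less)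
  qed (use that in fastforce)
  have sub: "{a..b} \<subseteq> I"
    using closed_segment_subset_interval[OF a(1) b(1)] a b by (auto simp: closed_segment_eq_real_ivl)
  have nhd: "at x within {a..b} = at x within I"
  proof (rule at_within_nhd)
    \<comment> \<open>If \<open>x\<close> is an endpoint of \<open>{a..b}\<close>, the window is
      extended past it by an arbitrary length 1, where \<open>I\<close> has no points.\<close>
    let ?S = "{if a < x then a else a - 1<..<if x < b then b else b + 1}"
    show "x \<in> ?S" "open ?S" using a b by auto
    have "t \<in> {a..b}" if "t \<in> I" "t \<in> ?S" for t
      using a b that by (auto split: if_splits)
    then show "{a..b} \<inter> ?S - {x} = I \<inter> ?S - {x}" using sub by blast
  qed
  have "((\<lambda>t. LBINT y=x0..t. u y) has_vector_derivative u x) (at x within {a..b})"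
    using a b by (intro interval_integral_FTC2 continuous_on_subset[OF u sub]) auto
  then show ?thesis
    unfolding nhd Dx_inv_def has_real_derivative_iff_has_vector_derivative .
qed

lemma Dx_inv_zero:
  assumes "\<And>t. t \<in> closed_segment x0 x \<Longrightarrow> u t = 0"
  shows "Dx_inv x0 u x = 0"
proof -
  have seg: "t \<in> closed_segment x0 x" if "t \<in> {min x0 x..max x0 x}" for t
    using that by (auto simp: closed_segment_eq_real_ivl min_def max_def split: if_splits)
  have u: "u t = 0" if "t \<in> {min x0 x..max x0 x}" for t using assms[OF seg[OF that]] .
  have "(LBINT \<xi>=ereal x0..ereal x. u \<xi>) = (\<lambda>_. 0) x - (\<lambda>_. 0) x0"
  proof (rule interval_integral_FTC_finite)
    show "continuous_on {min x0 x..max x0 x} u"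
      by (rule continuous_on_eq[OF continuous_on_const[of _ 0]]) (simp add: u)
    show "((\<lambda>_. 0) has_vector_derivative u t) (at t within {min x0 x..max x0 x})"
      if "min x0 x \<le> t" "t \<le> max x0 x" for t
      using u[of t] that by simp
  qed
  then show ?thesis by (simp add: Dx_inv_def)
qed

section \<open>Polynomial test functions\<close>

lemma polynomial_mem_bc_functions:
  assumes "x0 \<in> I" and "real_polynomial_function p"
  shows "(\<lambda>t. (t - x0)^2 * p t) \<in> bc_functions I x0 \<Phi>2 \<Phi>1"
proof -
  have "real_polynomial_function (\<lambda>t. (t - x0)^2 * p t)"
    using assms(2) by (rule real_polynomial_function_shift_power_mult)
  then have "smooth_on I (\<lambda>t. (t - x0)^2 * p t)" by (rule smooth_on_polynomial)
  \<comment> \<open>The double zero makes both the function and its derivative vanish at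
    \<open>x0\<close>, so the boundary condition holds whatever the coefficients are.\<close>
  moreover have "Dx I (\<lambda>t. (t - x0)^2 * p t) x0 = 0"
    using Dx_funpow_vanish[OF assms(2,1), of 1 2] by simp
  ultimately show ?thesis by (simp add: bc_functions_def)
qed

text \<open>
  Test functions vanishing to high order at \<^term>\<open>x\<close> and at \<^term>\<open>x0\<close> satisfy the boundary condition
  and are annihilated at \<^term>\<open>x\<close> by every differential operator of order below \<^term>\<open>N\<close>. Polynomial
  ones suffice, by the Weierstrass theorem.
\<close>
lemma zero_if_kernel_invisible:
  assumes "x0 \<in> I" and "x \<in> I" and "x \<noteq> x0" and f: "continuous_on I f"
    and invisible: "\<And>u. u \<in> bc_functions I x0 \<Phi>2 \<Phi>1 \<Longrightarrow> (\<And>i. i < N \<Longrightarrow> (Dx I ^^ i) u x = 0) \<Longrightarrow>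
        Dx_inv x0 (\<lambda>t. f t * u t) x = 0"
    and "t \<in> closed_segment x0 x"
  shows "f t = 0"
proof -
  define a where "a = min x0 x"
  define b where "b = max x0 x"
  have ab: "a < b" using \<open>x \<noteq> x0\<close> by (simp add: a_def b_def min_def max_def)
  have ends: "a = x0 \<and> b = x \<or> a = x \<and> b = x0" by (auto simp: a_def b_def min_def max_def)
  have seg: "{a..b} = closed_segment x0 x"
    using ab ends by (auto simp: closed_segment_eq_real_ivl)
  then have sub: "{a..b} \<subseteq> I"
    using closed_segment_subset_interval[OF assms(1,2)] by simp
  define w where "w = (\<lambda>t. (t - x0)^2 * (t - x)^N)"
  have w: "real_polynomial_function w"
    unfolding w_def
    by (rule real_polynomial_function_shift_power_mult)
       (rule real_polynomial_function_power[OF real_polynomial_function_shift])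
  have fw: "f s * w s = 0" if "s \<in> {a..b}" for s
  proof (rule zero_if_orthogonal_to_polynomials[of a b "\<lambda>s. f s * w s", OF _ ab _ that])
    show "continuous_on {a..b} (\<lambda>s. f s * w s)"
      by (rule continuous_on_mult[OF continuous_on_subset[OF f sub]
            continuous_on_real_polynomial_function[OF w]])
  next
    fix p :: "real \<Rightarrow> real" assume p: "real_polynomial_function p"
    define u where "u = (\<lambda>t. w t * p t)"
    have v: "continuous_on I (\<lambda>t. f t * u t)"
      unfolding u_def
      by (rule continuous_on_mult[OF f continuous_on_mult[OF
              continuous_on_real_polynomial_function[OF w] continuous_on_real_polynomial_function[OF p]]])
    have u1: "u = (\<lambda>t. (t - x0)^2 * ((t - x)^N * p t))"
      and u2: "u = (\<lambda>t. (t - x)^N * ((t - x0)^2 * p t))"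
      by (simp_all add: fun_eq_iff u_def w_def)
    have "u \<in> bc_functions I x0 \<Phi>2 \<Phi>1"
      unfolding u1
      by (rule polynomial_mem_bc_functions[OF assms(1) real_polynomial_function_shift_power_mult[OF p]])
    moreover have "(Dx I ^^ i) u x = 0" if "i < N" for i
      unfolding u2
      by (rule Dx_funpow_vanish[OF real_polynomial_function_shift_power_mult[OF p] assms(2) that])
    ultimately have F: "Dx_inv x0 (\<lambda>t. f t * u t) x = 0" by (rule invisible)
    have "((\<lambda>t. f t * u t) has_integral
        (Dx_inv x0 (\<lambda>t. f t * u t) b - Dx_inv x0 (\<lambda>t. f t * u t) a)) {a..b}"
    proof (rule fundamental_theorem_of_calculus)
      fix s assume "s \<in> {a..b}"
      then have "s \<in> I" using sub by blast
      have "(Dx_inv x0 (\<lambda>t. f t * u t) has_vector_derivative f s * u s) (at s within I)"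
        using has_derivative_Dx_inv[OF assms(1) \<open>s \<in> I\<close> v]
        by (simp only: has_real_derivative_iff_has_vector_derivative)
      then show "(Dx_inv x0 (\<lambda>t. f t * u t) has_vector_derivative f s * u s) (at s within {a..b})"
        by (rule has_vector_derivative_within_subset[OF _ sub])
    qed (use ab in simp)
    \<comment> \<open>One endpoint is \<open>x0\<close>, where the integral is empty; the other is
      \<open>x\<close>, where \<open>F\<close> applies.\<close>
    moreover have "Dx_inv x0 (\<lambda>t. f t * u t) b - Dx_inv x0 (\<lambda>t. f t * u t) a = 0"
      using ends F Dx_inv_base[of x0] by auto
    ultimately have "integral {a..b} (\<lambda>t. f t * u t) = 0" by (simp add: integral_unique)
    then show "integral {a..b} (\<lambda>s. f s * w s * p s) = 0" by (simp add: u_def mult.assoc)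
  qed
  \<comment> \<open>The weight \<open>w\<close> can vanish only at \<open>x0\<close> and
    \<open>x\<close>, so it cancels on the open segment; continuity of \<open>f\<close> reaches the
    endpoints.\<close>
  show ?thesis
  proof (rule continuous_const_on_dense[OF continuous_on_subset[OF f sub], of "{a<..<b}"])
    show "{a..b} \<subseteq> closure {a<..<b}" using ab by simp
    show "f s = 0" if "s \<in> {a<..<b}" for s
    proof -
      have "s \<noteq> x0" "s \<noteq> x" using that ends by auto
      then have "w s \<noteq> 0" by (simp add: w_def)
      then show ?thesis using fw[of s] that by simp
    qed
    show "{a<..<b} \<subseteq> {a..b}" by (rule greaterThanLessThan_subseteq_atLeastAtMost_iff[THEN iffD2]) simp
    show "t \<in> {a..b}" using assms(6) seg by simp
  qed
qed

end

section \<open>The action of the two operator products\<close>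

locale heisenberg_pair = real_interval I for I :: "real set" +
  fixes x0 :: real and \<Phi>0 \<Phi>1 \<Phi>2 g k :: "real \<Rightarrow> real"
  assumes x0: "x0 \<in> I"
    and regular: "Ck_on 2 I \<Phi>2" "Ck_on 1 I \<Phi>1" "Ck_on 0 I \<Phi>0" "Ck_on 2 I g" "Ck_on 2 I k"
    and \<Phi>2_nonzero: "\<exists>x\<in>I. \<Phi>2 x \<noteq> 0"
    and PM_differential: "differential_operator_on I (bc_functions I x0 \<Phi>2 \<Phi>1)
        (diff_op2 I \<Phi>2 \<Phi>1 \<Phi>0 \<circ> int_op1 x0 g k)"
    and MP_differential: "differential_operator_on I (bc_functions I x0 \<Phi>2 \<Phi>1)
        (int_op1 x0 g k \<circ> diff_op2 I \<Phi>2 \<Phi>1 \<Phi>0)"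
    and Heisenberg: "\<forall>u\<in>bc_functions I x0 \<Phi>2 \<Phi>1. \<forall>x\<in>I.
        commutator (diff_op2 I \<Phi>2 \<Phi>1 \<Phi>0) (int_op1 x0 g k) u x = u x"
begin

abbreviation "g' \<equiv> Dx I g"
abbreviation "g'' \<equiv> Dx I g'"
abbreviation "k' \<equiv> Dx I k"
abbreviation "k'' \<equiv> Dx I k'"
abbreviation "\<Phi>2' \<equiv> Dx I \<Phi>2"
abbreviation "\<Phi>2'' \<equiv> Dx I \<Phi>2'"
abbreviation "\<Phi>1' \<equiv> Dx I \<Phi>1"

text \<open>
  The nonlocal part of \<open>P M u\<close> is \<open>PM_kernel \<cdot> D\<^sup>-\<^sup>1 u\<close>, that of \<open>M P u\<close> is \<open>g \<cdot> D\<^sup>-\<^sup>1 (MP_kernel \<cdot> u)\<close>.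
\<close>
definition PM_kernel :: "real \<Rightarrow> real" where
  "PM_kernel x = \<Phi>2 x * g'' x + \<Phi>1 x * g' x + \<Phi>0 x * g x"

definition MP_kernel :: "real \<Rightarrow> real" where
  "MP_kernel x = \<Phi>2'' x - \<Phi>1' x + \<Phi>0 x"

lemma derivs:
  assumes "x \<in> I"
  shows "(g has_real_derivative g' x) (at x within I)" "(g' has_real_derivative g'' x) (at x within I)"
    "(k has_real_derivative k' x) (at x within I)" "(k' has_real_derivative k'' x) (at x within I)"
    "(\<Phi>2 has_real_derivative \<Phi>2' x) (at x within I)" "(\<Phi>2' has_real_derivative \<Phi>2'' x) (at x within I)"
    "(\<Phi>1 has_real_derivative \<Phi>1' x) (at x within I)"
  using regular assms by (simp_all add: Ck_on_Suc numeral_2_eq_2)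

lemma conts:
  "continuous_on I g" "continuous_on I g'" "continuous_on I g''"
  "continuous_on I k" "continuous_on I k'" "continuous_on I k''"
  "continuous_on I \<Phi>2" "continuous_on I \<Phi>2'" "continuous_on I \<Phi>2''"
  "continuous_on I \<Phi>1" "continuous_on I \<Phi>1'" "continuous_on I \<Phi>0"
  using regular by (simp_all add: Ck_on_Suc Ck_on_0 numeral_2_eq_2 Ck_on_imp_continuous)
    (auto intro!: DERIV_continuous_on)

text \<open>Leibniz rule, with \<open>u\<close> as the derivative of \<open>Dx_inv x0 u\<close>. The
  coefficient \<open>PM_kernel\<close> collects the terms in which that integral stays
  undifferentiated: it is \<open>P\<close> applied to \<open>g\<close>.\<close>

lemma PM_formula:
  assumes u: "smooth_on I u" and "x \<in> I"
  shows "diff_op2 I \<Phi>2 \<Phi>1 \<Phi>0 (int_op1 x0 g k u) x =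
    PM_kernel x * Dx_inv x0 u x +
    (\<Phi>2 x * (2 * g' x + k'' x) + \<Phi>1 x * (g x + k' x) + \<Phi>0 x * k x) * u x +
    (\<Phi>2 x * (g x + 2 * k' x) + \<Phi>1 x * k x) * Dx I u x + \<Phi>2 x * k x * Dx I (Dx I u) x"
proof -
  let ?U = "Dx_inv x0 u"
  note du = smooth_on_Dx(3)[OF u] smooth_on_Dx(3)[OF smooth_on_Dx(1)[OF u]]
    has_derivative_Dx_inv[OF x0 _ smooth_on_Dx(2)[OF u]]
  let ?M1 = "\<lambda>t. g' t * ?U t + g t * u t + (k' t * u t + k t * Dx I u t)"
  have M1: "Dx I (int_op1 x0 g k u) t = ?M1 t" if t: "t \<in> I" for t
    unfolding int_op1_def
    by (rule Dx_eqI[OF t], rule DERIV_cong, (rule DERIV_add DERIV_mult derivs[OF t] du[OF t])+)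
       (simp add: algebra_simps)
  have "Dx I (Dx I (int_op1 x0 g k u)) x = Dx I ?M1 x"
    using M1 \<open>x \<in> I\<close> by (rule Dx_cong)
  also have "\<dots> = g'' x * ?U x + 2 * g' x * u x + g x * Dx I u x +
      (k'' x * u x + 2 * k' x * Dx I u x + k x * Dx I (Dx I u) x)"
    by (rule Dx_eqI[OF \<open>x \<in> I\<close>], rule DERIV_cong,
        (rule DERIV_add DERIV_mult derivs[OF \<open>x \<in> I\<close>] du[OF \<open>x \<in> I\<close>])+) algebra
  finally show ?thesis
    unfolding diff_op2_def M1[OF \<open>x \<in> I\<close>] PM_kernel_def
    by (simp add: int_op1_def algebra_simps)
qed

text \<open>Integration by parts; the boundary condition removes exactly the boundary term at the base point.\<close>
lemma MP_formula:
  assumes "u \<in> bc_functions I x0 \<Phi>2 \<Phi>1" and "x \<in> I"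
  shows "int_op1 x0 g k (diff_op2 I \<Phi>2 \<Phi>1 \<Phi>0 u) x =
    g x * (\<Phi>2 x * Dx I u x - \<Phi>2' x * u x + \<Phi>1 x * u x + Dx_inv x0 (\<lambda>t. MP_kernel t * u t) x) +
    k x * (\<Phi>2 x * Dx I (Dx I u) x + \<Phi>1 x * Dx I u x + \<Phi>0 x * u x)"
proof -
  have u: "smooth_on I u" and bc: "\<Phi>2 x0 * Dx I u x0 - \<Phi>2' x0 * u x0 + \<Phi>1 x0 * u x0 = 0"
    using assms(1) by (auto simp: bc_functions_def)
  note cu = smooth_on_Dx(2)[OF u] smooth_on_Dx(2)[OF smooth_on_Dx(1)[OF u]]
    smooth_on_Dx(2)[OF smooth_on_Dx(1)[OF smooth_on_Dx(1)[OF u]]]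
  have hu: "continuous_on I (\<lambda>t. MP_kernel t * u t)"
    unfolding MP_kernel_def by (intro continuous_intros conts cu)
  note du = smooth_on_Dx(3)[OF u] smooth_on_Dx(3)[OF smooth_on_Dx(1)[OF u]]
    has_derivative_Dx_inv[OF x0 _ hu]
  \<comment> \<open>This is an antiderivative of \<open>P u\<close>: the terms in front form the
    bilinear concomitant of \<open>u\<close> and 1, and \<open>MP_kernel\<close> is the formal
    adjoint of \<open>P\<close> applied to 1.\<close>
  let ?F = "\<lambda>t. \<Phi>2 t * Dx I u t - \<Phi>2' t * u t + \<Phi>1 t * u t + Dx_inv x0 (\<lambda>t. MP_kernel t * u t) t"
  have "Dx_inv x0 (diff_op2 I \<Phi>2 \<Phi>1 \<Phi>0 u) x = ?F x - ?F x0"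
  proof (rule Dx_inv_eq_diff[OF x0 \<open>x \<in> I\<close>])
    show "continuous_on I (diff_op2 I \<Phi>2 \<Phi>1 \<Phi>0 u)"
      unfolding diff_op2_def by (intro continuous_intros conts cu)
    show "(?F has_real_derivative diff_op2 I \<Phi>2 \<Phi>1 \<Phi>0 u t) (at t within I)" if t: "t \<in> I" for t
      unfolding diff_op2_def
      by (rule DERIV_cong, (rule DERIV_add DERIV_diff DERIV_mult derivs[OF t] du[OF t])+)
         (simp add: MP_kernel_def algebra_simps)
  qed
  also have "?F x0 = 0" using bc Dx_inv_base by simp
  finally show ?thesis by (simp add: int_op1_def diff_op2_def)
qed

section \<open>Vanishing kernels and the coefficient equations\<close>

lemma PM_kernel_zero_off_base:
  assumes "x \<in> I" and "x \<noteq> x0"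
  shows "PM_kernel x = 0"
proof -
  obtain n a where na: "\<And>u. u \<in> bc_functions I x0 \<Phi>2 \<Phi>1 \<Longrightarrow>
      diff_op2 I \<Phi>2 \<Phi>1 \<Phi>0 (int_op1 x0 g k u) x = (\<Sum>i\<le>n. a i x * (Dx I ^^ i) u x)"
    using PM_differential \<open>x \<in> I\<close> unfolding differential_operator_on_def comp_def by blast
  show ?thesis
  \<comment> \<open>At fixed \<open>x\<close> the kernel is a constant function. The order
    \<open>n + 3\<close> exceeds both \<open>n\<close>, the order of the assumed differential
    operator, and 2, the order of the local terms.\<close>
  proof (rule zero_if_kernel_invisible[OF x0 assms continuous_on_const, where t = x and N = "n + 3"])
    fix u assume u: "u \<in> bc_functions I x0 \<Phi>2 \<Phi>1" and van: "\<And>i. i < n + 3 \<Longrightarrow> (Dx I ^^ i) u x = 0"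
    have smooth: "smooth_on I u" using u by (simp add: bc_functions_def)
    have "(\<Sum>i\<le>n. a i x * (Dx I ^^ i) u x) = 0" using van by (intro sum.neutral) simp
    then have "PM_kernel x * Dx_inv x0 u x = 0"
      using na[OF u] PM_formula[OF smooth \<open>x \<in> I\<close>] van[of 0] van[of 1] van[of 2]
      by (simp add: numeral_2_eq_2)
    moreover have "Dx_inv x0 (\<lambda>t. PM_kernel x * u t) x = PM_kernel x * Dx_inv x0 u x"
      by (simp add: Dx_inv_def)
    ultimately show "Dx_inv x0 (\<lambda>t. PM_kernel x * u t) x = 0" by simp
  qed simp
qed

text \<open>Here the kernel varies along the segment of integration; the factor \<open>g x\<close>
  stays inside it, as it may be zero.\<close>

lemma MP_kernel_zero_off_base:
  assumes "x \<in> I" and "x \<noteq> x0" and t: "t \<in> closed_segment x0 x"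
  shows "g x * MP_kernel t = 0"
proof -
  obtain n a where na: "\<And>u. u \<in> bc_functions I x0 \<Phi>2 \<Phi>1 \<Longrightarrow>
      int_op1 x0 g k (diff_op2 I \<Phi>2 \<Phi>1 \<Phi>0 u) x = (\<Sum>i\<le>n. a i x * (Dx I ^^ i) u x)"
    using MP_differential \<open>x \<in> I\<close> unfolding differential_operator_on_def comp_def by blast
  show ?thesis
  proof (rule zero_if_kernel_invisible[OF x0 assms(1,2) _ _ t, where N = "n + 3"])
    show "continuous_on I (\<lambda>t. g x * MP_kernel t)"
      unfolding MP_kernel_def by (intro continuous_intros conts)
    fix u assume u: "u \<in> bc_functions I x0 \<Phi>2 \<Phi>1" and van: "\<And>i. i < n + 3 \<Longrightarrow> (Dx I ^^ i) u x = 0"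
    have "(\<Sum>i\<le>n. a i x * (Dx I ^^ i) u x) = 0" using van by (intro sum.neutral) simp
    then have "g x * Dx_inv x0 (\<lambda>t. MP_kernel t * u t) x = 0"
      using na[OF u] MP_formula[OF u \<open>x \<in> I\<close>] van[of 0] van[of 1] van[of 2]
      by (simp add: numeral_2_eq_2)
    moreover have "Dx_inv x0 (\<lambda>t. g x * (MP_kernel t * u t)) x = g x * Dx_inv x0 (\<lambda>t. MP_kernel t * u t) x"
      by (simp add: Dx_inv_def)
    ultimately show "Dx_inv x0 (\<lambda>t. g x * MP_kernel t * u t) x = 0" by (simp add: mult.assoc)
  qed
qed

text \<open>With both nonlocal terms gone, the second-order terms cancel, as do those with
  \<open>\<Phi>1 * k\<close>, \<open>\<Phi>0 * k\<close>, \<open>g * \<Phi>1\<close> and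
  \<open>g * \<Phi>2 * Dx I u\<close>.\<close>

lemma Heisenberg_local:
  assumes u: "u \<in> bc_functions I x0 \<Phi>2 \<Phi>1" and "x \<in> I" and "x \<noteq> x0"
  shows "(\<Phi>2 x * (2 * g' x + k'' x) + \<Phi>1 x * k' x + g x * \<Phi>2' x) * u x + 2 * \<Phi>2 x * k' x * Dx I u x = u x"
proof -
  have smooth: "smooth_on I u" using u by (simp add: bc_functions_def)
  \<comment> \<open>Unless \<open>g x\<close> is zero, \<open>MP_kernel\<close> vanishes on the
    whole segment from \<open>x0\<close> to \<open>x\<close>, and so does the integral.\<close>
  have "g x * Dx_inv x0 (\<lambda>t. MP_kernel t * u t) x = 0"
    using MP_kernel_zero_off_base[OF assms(2,3)] Dx_inv_zero[of x0 x "\<lambda>t. MP_kernel t * u t"]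
    by (cases "g x = 0") auto
  moreover have "commutator (diff_op2 I \<Phi>2 \<Phi>1 \<Phi>0) (int_op1 x0 g k) u x = u x"
    using Heisenberg u \<open>x \<in> I\<close> by blast
  ultimately show ?thesis
    unfolding commutator_def comp_def PM_formula[OF smooth \<open>x \<in> I\<close>] MP_formula[OF u \<open>x \<in> I\<close>]
      PM_kernel_zero_off_base[OF assms(2,3)]
    by (simp add: algebra_simps)
qed

text \<open>The test-function arguments need a nondegenerate segment and say nothing at
  \<open>x0\<close>; as \<open>x0\<close> is not isolated in \<open>I\<close>, continuity supplies
  the value there.\<close>

lemma const_if_const_off_base:
  fixes f :: "real \<Rightarrow> real"
  assumes "continuous_on I f" and "\<And>t. t \<in> I \<Longrightarrow> t \<noteq> x0 \<Longrightarrow> f t = c" and "x \<in> I"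
  shows "f x = c"
  by (rule continuous_const_on_dense[OF assms(1) _ interval_subset_closure_minus[of x0] _ assms(3)])
     (use assms(2) in auto)

lemma coefficient_equations:
  assumes "x \<in> I"
  shows "PM_kernel x = 0" and "MP_kernel x * g x = 0" and "\<Phi>2 x * k' x = 0"
    and "\<Phi>2 x * (2 * g' x + k'' x) + \<Phi>1 x * k' x + g x * \<Phi>2' x = 1"
proof -
  show "PM_kernel x = 0"
    by (rule const_if_const_off_base[OF _ PM_kernel_zero_off_base assms])
       (auto simp: PM_kernel_def[abs_def] intro!: continuous_on_add continuous_on_mult conts)
  show "MP_kernel x * g x = 0"
  proof (rule const_if_const_off_base[OF _ _ assms])
    show "continuous_on I (\<lambda>x. MP_kernel x * g x)"
      unfolding MP_kernel_def by (intro continuous_intros conts)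
    show "MP_kernel t * g t = 0" if "t \<in> I" "t \<noteq> x0" for t
      using MP_kernel_zero_off_base[OF that, of t] by (simp add: mult.commute)
  qed
  have *: "\<Phi>2 t * k' t = 0" if t: "t \<in> I" "t \<noteq> x0" for t
  proof -
    \<comment> \<open>The simple zero at \<open>t\<close> removes the zeroth-order term and leaves
      the derivative \<open>(t - x0)^2\<close>, which is nonzero.\<close>
    let ?u = "\<lambda>s. (s - x0)^2 * (s - t)"
    note u = polynomial_mem_bc_functions[OF x0 real_polynomial_function_shift[of t]]
    have "Dx I ?u t = (t - x0)^2"
      by (rule Dx_eqI[OF t(1)]) (auto intro!: derivative_eq_intros)
    then show ?thesis using Heisenberg_local[OF u t] t(2) by simp
  qed
  show "\<Phi>2 x * k' x = 0"
    by (rule const_if_const_off_base[OF _ * assms]) (auto intro!: continuous_on_mult conts)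
  show "\<Phi>2 x * (2 * g' x + k'' x) + \<Phi>1 x * k' x + g x * \<Phi>2' x = 1"
  proof (rule const_if_const_off_base[OF _ _ assms])
    show "continuous_on I (\<lambda>x. \<Phi>2 x * (2 * g' x + k'' x) + \<Phi>1 x * k' x + g x * \<Phi>2' x)"
      by (intro continuous_intros conts)
    fix t assume t: "t \<in> I" "t \<noteq> x0"
    \<comment> \<open>This test function is nonzero at \<open>t\<close>; its derivative term drops
      out by \<open>*\<close>, which leaves only the zeroth-order coefficient.\<close>
    have "(\<lambda>s. (s - x0)^2 * 1) \<in> bc_functions I x0 \<Phi>2 \<Phi>1"
      by (rule polynomial_mem_bc_functions[OF x0 real_polynomial_function.intros(2)])
    from Heisenberg_local[OF this t]
    have "(\<Phi>2 t * (2 * g' t + k'' t) + \<Phi>1 t * k' t + g t * \<Phi>2' t) * (t - x0)^2 = (t - x0)^2"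
      using *[OF t] by auto
    then show "\<Phi>2 t * (2 * g' t + k'' t) + \<Phi>1 t * k' t + g t * \<Phi>2' t = 1" using t(2) by simp
  qed
qed

section \<open>Solving the coefficient equations\<close>

lemma Dx_zero_if_locally_zero:
  assumes "x \<in> I" and "e > 0" and "\<And>t. t \<in> I \<Longrightarrow> dist t x < e \<Longrightarrow> f t = 0"
  shows "Dx I f x = 0"
  by (rule Dx_eqI[OF assms(1) has_field_derivative_transform_within[OF DERIV_const assms(2,1)]])
     (use assms(3) in auto)

text \<open>
  Where \<^term>\<open>k'\<close> does not vanish, \<^term>\<open>\<Phi>2\<close> vanishes locally, so the last coefficient equation leaves
  \<open>\<Phi>1 k' = 1\<close>. Thus \<open>\<Phi>1 k'\<close> is a continuous function on \<^term>\<open>I\<close> with values in \<open>{0, 1}\<close>, hence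
  constant, and the value \<open>1\<close> would force \<^term>\<open>\<Phi>2\<close> to vanish identically.
\<close>
lemma k'_zero:
  assumes "x \<in> I"
  shows "k' x = 0"
proof (rule ccontr)
  let ?f = "\<lambda>t. \<Phi>1 t * k' t"
  have one: "?f t = 1" if t: "t \<in> I" "k' t \<noteq> 0" for t
  proof -
    obtain e where "e > 0" and e: "\<And>s. s \<in> I \<Longrightarrow> dist s t < e \<Longrightarrow> k' s \<noteq> 0"
      using continuous_on_avoid[OF conts(5) t] by (auto simp: dist_commute)
    have "\<Phi>2' t = 0"
      using coefficient_equations(3) e by (intro Dx_zero_if_locally_zero[OF t(1) \<open>e > 0\<close>]) force
    then show ?thesis
      using coefficient_equations(3,4)[OF t(1)] t(2) by simp
  qed
  assume "k' x \<noteq> 0"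
  then have fx: "?f x = 1" using one assms by blast
  obtain y where y: "y \<in> I" "\<Phi>2 y \<noteq> 0" using \<Phi>2_nonzero by blast
  then have fy: "?f y = 0" using coefficient_equations(3)[of y] by simp
  have "connected (?f ` I)"
    by (intro connected_continuous_image continuous_intros conts)
       (use interval in \<open>simp add: is_interval_connected_1\<close>)
  then have "1/2 \<in> ?f ` I"
    using connectedD_interval[of "?f ` I" "?f y" "?f x" "1/2"] fx fy assms y(1) by simp
  then obtain z where "z \<in> I" "?f z = 1/2" by force
  then show False using one[of z] by (cases "k' z = 0") auto
qed

lemma const_if_derivative_zero:
  fixes f :: "real \<Rightarrow> real"
  assumes "\<And>x. x \<in> I \<Longrightarrow> (f has_real_derivative 0) (at x within I)"
  obtains c where "\<And>x. x \<in> I \<Longrightarrow> f x = c"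
proof -
  have "convex I" using interval by (simp add: is_interval_convex_1)
  then show ?thesis using has_field_derivative_zero_constant[of I f] assms that by blast
qed

lemma k_const: obtains k0 where "\<And>x. x \<in> I \<Longrightarrow> k x = k0"
proof (rule const_if_derivative_zero)
  show "(k has_real_derivative 0) (at x within I)" if "x \<in> I" for x
    using derivs(3)[OF that] k'_zero[OF that] by simp
next
  fix c assume "\<And>x. x \<in> I \<Longrightarrow> k x = c"
  then show thesis by (rule that)
qed

lemma product_equation:
  assumes "x \<in> I"
  shows "2 * g' x * \<Phi>2 x + g x * \<Phi>2' x = 1"
proof -
  have "k'' x = 0"
    using k'_zero by (intro Dx_zero_if_locally_zero[OF assms zero_less_one])
  then show ?thesis using coefficient_equations(4)[OF assms] k'_zero[OF assms] by (simp add: mult_ac)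
qed

text \<open>If \<open>g\<close> vanished near \<open>x\<close>, so would its derivative at
  \<open>x\<close>, and \<open>product_equation\<close> would read 0 = 1. This density gives meaning
  to the final formulas, which divide by powers of \<open>g\<close>.\<close>

lemma g_nonzero_dense: "I \<subseteq> closure {x\<in>I. g x \<noteq> 0}"
proof
  fix x assume x: "x \<in> I"
  show "x \<in> closure {x\<in>I. g x \<noteq> 0}"
  proof (rule ccontr)
    assume "x \<notin> closure {x\<in>I. g x \<noteq> 0}"
    then obtain e where "e > 0" and e: "\<And>t. t \<in> I \<Longrightarrow> dist t x < e \<Longrightarrow> g t = 0"
      by (auto simp: closure_approachable)
    have "g' x = 0" by (rule Dx_zero_if_locally_zero[OF x \<open>e > 0\<close> e])
    moreover have "g x = 0" using e[OF x] \<open>e > 0\<close> by simp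
    ultimately show False using product_equation[OF x] by simp
  qed
qed

lemma MP_kernel_zero:
  assumes "x \<in> I"
  shows "MP_kernel x = 0"
proof (rule continuous_const_on_dense[OF _ _ g_nonzero_dense _ assms])
  show "continuous_on I MP_kernel"
    unfolding MP_kernel_def[abs_def] by (intro continuous_intros conts)
qed (use coefficient_equations(2) in auto)

text \<open>\<open>g\<close> is an integrating factor: \<open>g\<close> times
  \<open>product_equation\<close> says that \<open>g^2 * \<Phi>2\<close> has derivative
  \<open>g\<close>.\<close>

lemma \<Phi>2_integrated:
  obtains c0 where "\<And>x. x \<in> I \<Longrightarrow> (g x)^2 * \<Phi>2 x = Dx_inv x0 g x + c0"
proof (rule const_if_derivative_zero)
  fix x assume x: "x \<in> I"
  note d = derivs[OF x] has_derivative_Dx_inv[OF x0 x conts(1)]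
  show "((\<lambda>x. g x * g x * \<Phi>2 x - Dx_inv x0 g x) has_real_derivative 0) (at x within I)"
  proof (rule DERIV_cong, (rule DERIV_diff DERIV_mult d)+)
    have "(g' x * g x + g' x * g x) * \<Phi>2 x + \<Phi>2' x * (g x * g x) - g x =
        g x * (2 * g' x * \<Phi>2 x + g x * \<Phi>2' x) - g x"
      by (simp add: algebra_simps)
    then show "(g' x * g x + g' x * g x) * \<Phi>2 x + \<Phi>2' x * (g x * g x) - g x = 0"
      unfolding product_equation[OF x] by simp
  qed
next
  fix c assume "\<And>x. x \<in> I \<Longrightarrow> g x * g x * \<Phi>2 x - Dx_inv x0 g x = c"
  then show thesis by (intro that[of c]) (simp add: power2_eq_square algebra_simps)
qed

text \<open>
  As both kernels vanish, this expression has the same derivative as the left-hand side of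
  \<open>product_equation\<close>.
\<close>
lemma \<Phi>1_integrated:
  obtains c where "\<And>x. x \<in> I \<Longrightarrow> g x * \<Phi>1 x + 3 * \<Phi>2 x * g' x = c"
proof (rule const_if_derivative_zero)
  fix x assume x: "x \<in> I"
  note d = derivs[OF x]
  have "((\<lambda>x. 2 * g' x * \<Phi>2 x + g x * \<Phi>2' x) has_real_derivative
      2 * g'' x * \<Phi>2 x + 3 * g' x * \<Phi>2' x + g x * \<Phi>2'' x) (at x within I)"
    by (rule DERIV_cong, (rule DERIV_add DERIV_cmult DERIV_mult d)+) (simp add: algebra_simps)
  \<comment> \<open>On \<open>I\<close> this function agrees with the constant 1, so its computed
    derivative must be zero.\<close>
  moreover have "((\<lambda>x. 2 * g' x * \<Phi>2 x + g x * \<Phi>2' x) has_real_derivative 0) (at x within I)"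
    using has_derivative_cong_interval[where h = "\<lambda>_. 1" and y = 0, OF product_equation x] by simp
  ultimately have D: "2 * g'' x * \<Phi>2 x + 3 * g' x * \<Phi>2' x + g x * \<Phi>2'' x = 0"
    by (rule trans[OF Dx_eqI[OF x, symmetric] Dx_eqI[OF x]])
  show "((\<lambda>x. g x * \<Phi>1 x + 3 * \<Phi>2 x * g' x) has_real_derivative 0) (at x within I)"
  proof (rule DERIV_cong, (rule DERIV_add DERIV_cmult DERIV_mult d)+)
    \<comment> \<open>The terms with \<open>\<Phi>0\<close> cancel between the two kernels, and
      those with \<open>\<Phi>2''\<close> between \<open>MP_kernel\<close> and the last
      bracket.\<close>
    have "g' x * \<Phi>1 x + \<Phi>1' x * g x + (3 * \<Phi>2' x * g' x + g'' x * (3 * \<Phi>2 x)) =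
        PM_kernel x - g x * MP_kernel x + (2 * g'' x * \<Phi>2 x + 3 * g' x * \<Phi>2' x + g x * \<Phi>2'' x)"
      by (simp add: PM_kernel_def MP_kernel_def algebra_simps)
    then show "g' x * \<Phi>1 x + \<Phi>1' x * g x + (3 * \<Phi>2' x * g' x + g'' x * (3 * \<Phi>2 x)) = 0"
      unfolding D MP_kernel_zero[OF x] coefficient_equations(1)[OF x] by simp
  qed
next
  fix c assume "\<And>x. x \<in> I \<Longrightarrow> g x * \<Phi>1 x + 3 * \<Phi>2 x * g' x = c"
  then show thesis by (rule that)
qed

end

section \<open>Explicit form of the operators\<close>

theorem mainTheorem2:
  fixes I :: "real set" and x0 :: real
    and \<Phi>0 \<Phi>1 \<Phi>2 g k :: "real \<Rightarrow> real"
    and P M :: "(real \<Rightarrow> real) \<Rightarrow> real \<Rightarrow> real"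
  assumes "is_interval I" and "interior I \<noteq> {}" and "x0 \<in> I"
    and "Ck_on 2 I \<Phi>2" and "Ck_on 1 I \<Phi>1" and "Ck_on 0 I \<Phi>0"
    and "Ck_on 2 I g" and "Ck_on 2 I k"
    and "\<exists>x\<in>I. \<Phi>2 x \<noteq> 0" and "\<exists>x\<in>I. g x \<noteq> 0"
    and "P = diff_op2 I \<Phi>2 \<Phi>1 \<Phi>0" and "M = int_op1 x0 g k"
    and "differential_operator_on I (bc_functions I x0 \<Phi>2 \<Phi>1) (P \<circ> M)"
    and "differential_operator_on I (bc_functions I x0 \<Phi>2 \<Phi>1) (M \<circ> P)"
    and "\<forall>u\<in>bc_functions I x0 \<Phi>2 \<Phi>1. \<forall>x\<in>I. commutator P M u x = u x"
  shows "\<exists>(c0::real) (c1::real) (k0::real) (Y :: real \<Rightarrow> real) Y1 Y2 Y3.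
    Y x0 = 0 \<and> (\<forall>x\<in>I. Y x = Dx_inv x0 g x) \<and>
    Y1 = Dx I Y \<and> Y2 = Dx I Y1 \<and> Y3 = Dx I Y2 \<and> Ck_on 3 I Y \<and>
    I \<subseteq> closure {x\<in>I. Y1 x \<noteq> 0} \<and>
    (\<forall>x\<in>I. Y1 x \<noteq> 0 \<longrightarrow>
       \<Phi>2 x = 1 / (Y1 x)^2 * (Y x + c0) \<and>
       \<Phi>1 x = 1 / (Y1 x)^3 * ((c1 + 3) * (Y1 x)^2 - 3 * (Y x + c0) * Y2 x) \<and>
       \<Phi>0 x = - (1 / (Y1 x)^4 *
         ((Y x + c0) * (Y3 x * Y1 x - 3 * (Y2 x)^2) + (c1 + 3) * (Y1 x)^2 * Y2 x))) \<and>
    (\<forall>x\<in>I. g x = Y1 x \<and> k x = k0)"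
proof -
  interpret heisenberg_pair I x0 \<Phi>0 \<Phi>1 \<Phi>2 g k
    by unfold_locales (fact assms assms(13-15)[unfolded assms(11,12)])+
  obtain k0 where k0: "\<And>x. x \<in> I \<Longrightarrow> k x = k0" using k_const by blast
  obtain c0 where c0: "\<And>x. x \<in> I \<Longrightarrow> (g x)^2 * \<Phi>2 x = Dx_inv x0 g x + c0"
    using \<Phi>2_integrated by blast
  obtain c where c: "\<And>x. x \<in> I \<Longrightarrow> g x * \<Phi>1 x + 3 * \<Phi>2 x * g' x = c"
    using \<Phi>1_integrated by blast
  define Y where "Y = Dx_inv x0 g"
  have dY: "(Y has_real_derivative g x) (at x within I)" if "x \<in> I" for x
    unfolding Y_def by (rule has_derivative_Dx_inv[OF x0 that conts(1)])
  have Y1: "Dx I Y x = g x" if "x \<in> I" for x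
    using Dx_eqI[OF that dY[OF that]] .
  have Y2: "Dx I (Dx I Y) x = g' x" if "x \<in> I" for x
    using Dx_cong[OF Y1 that] .
  have Y3: "Dx I (Dx I (Dx I Y)) x = g'' x" if "x \<in> I" for x
    using Dx_cong[OF Y2 that] .
  have "Ck_on 2 I (Dx I Y)"
    by (rule Ck_on_cong[OF Y1[symmetric] regular(4)])
  then have "Ck_on 3 I Y"
    using dY Y1 by (simp add: Ck_on_Suc numeral_3_eq_3 numeral_2_eq_2)
  moreover have "I \<subseteq> closure {x\<in>I. Dx I Y x \<noteq> 0}"
  proof -
    have "{x\<in>I. Dx I Y x \<noteq> 0} = {x\<in>I. g x \<noteq> 0}" using Y1 by auto
    then show ?thesis using g_nonzero_dense by simp
  qed
  \<comment> \<open>The integration constant \<open>c\<close> of \<open>\<Phi>1_integrated\<close>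
    plays the role of \<open>c1 + 3\<close>, so the witness for \<open>c1\<close> is
    \<open>c - 3\<close>.\<close>
  moreover have "\<Phi>2 x = 1 / (Dx I Y x)^2 * (Y x + c0) \<and>
       \<Phi>1 x = 1 / (Dx I Y x)^3 * ((c - 3 + 3) * (Dx I Y x)^2 - 3 * (Y x + c0) * Dx I (Dx I Y) x) \<and>
       \<Phi>0 x = - (1 / (Dx I Y x)^4 *
         ((Y x + c0) * (Dx I (Dx I (Dx I Y)) x * Dx I Y x - 3 * (Dx I (Dx I Y) x)^2) +
          (c - 3 + 3) * (Dx I Y x)^2 * Dx I (Dx I Y) x))"
    if x: "x \<in> I" and "Dx I Y x \<noteq> 0" for x
  proof -
    have g: "g x \<noteq> 0" using that Y1 by simp
    have A: "(g x)^2 * \<Phi>2 x = Y x + c0" using c0[OF x] by (simp add: Y_def)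
    \<comment> \<open>The first integral for \<open>\<Phi>1\<close> is multiplied by
      \<open>g^2\<close>, so that \<open>A\<close> can replace \<open>g^2 * \<Phi>2\<close>.\<close>
    have B: "(g x)^3 * \<Phi>1 x = c * (g x)^2 - 3 * (Y x + c0) * g' x"
    proof -
      have "(g x)^3 * \<Phi>1 x + 3 * ((g x)^2 * \<Phi>2 x) * g' x = (g x)^2 * (g x * \<Phi>1 x + 3 * \<Phi>2 x * g' x)"
        by (simp add: power2_eq_square power3_eq_cube algebra_simps)
      then show ?thesis unfolding A c[OF x] by (simp add: algebra_simps)
    qed
    \<comment> \<open>The equation \<open>PM_kernel x = 0\<close>, multiplied by \<open>g^3\<close>,
      is solved for \<open>\<Phi>0\<close> after substituting \<open>A\<close> and
      \<open>B\<close>.\<close>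
    have C: "(g x)^4 * \<Phi>0 x = - ((Y x + c0) * (g'' x * g x - 3 * (g' x)^2) + c * (g x)^2 * g' x)"
    proof -
      have "(g x)^4 * \<Phi>0 x + g x * ((g x)^2 * \<Phi>2 x) * g'' x + ((g x)^3 * \<Phi>1 x) * g' x =
          (g x)^3 * PM_kernel x"
        by (simp add: PM_kernel_def power2_eq_square power3_eq_cube power4_eq_xxxx algebra_simps)
      then show ?thesis
        unfolding A B coefficient_equations(1)[OF x]
        by (simp add: power2_eq_square algebra_simps)
    qed
    show ?thesis
      unfolding Y1[OF x] Y2[OF x] Y3[OF x]
    proof (intro conjI)
      show "\<Phi>2 x = 1 / (g x)^2 * (Y x + c0)"
        using g by (simp add: A[symmetric])
      have "c * (g x)^2 - 3 * (Y x + c0) * g' x = (g x)^3 * \<Phi>1 x" using B by simp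
      then show "\<Phi>1 x = 1 / (g x)^3 * ((c - 3 + 3) * (g x)^2 - 3 * (Y x + c0) * g' x)"
        using g by simp
      have "(Y x + c0) * (g'' x * g x - 3 * (g' x)^2) + c * (g x)^2 * g' x = - ((g x)^4 * \<Phi>0 x)"
        using C by simp
      then show "\<Phi>0 x = - (1 / (g x)^4 *
          ((Y x + c0) * (g'' x * g x - 3 * (g' x)^2) + (c - 3 + 3) * (g x)^2 * g' x))"
        using g by simp
    qed
  qed
  moreover have "Y x0 = 0" by (simp add: Y_def Dx_inv_base)
  moreover have "\<forall>x\<in>I. Y x = Dx_inv x0 g x" by (simp add: Y_def)
  moreover have "\<forall>x\<in>I. g x = Dx I Y x \<and> k x = k0" using k0 Y1 by simp
  ultimately show ?thesis
    by - (rule exI[of _ c0], rule exI[of _ "c - 3"], rule exI[of _ k0], rule exI[of _ Y],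
        rule exI[of _ "Dx I Y"], rule exI[of _ "Dx I (Dx I Y)"],
        rule exI[of _ "Dx I (Dx I (Dx I Y))"], intro conjI refl ballI impI; blast)
qed

end
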